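(* Let $M$ be a complete Riemannian manifold, let $E:M\to M$, $\alpha:M\times M\to\mathbb{R}\setminus\{0\}$ and $\eta:M\times M\to TM$ be functions with $\alpha(x,y)\eta(x,y)\in T_yM$ for all $x,y\in M$, and let $S\subset M$ be an open geodesic $(\alpha,E)$-invex set with respect to $\eta$ and $\alpha$. If a function $f:S\to\mathbb{R}$ is differentiable and geodesic $(\alpha,E)$-preinvex on $S$, then $f$ is a geodesic $(\alpha,E)$-invex function on $S$.
   Context: Geodesic $(\alpha,E)$-invex set: a nonempty subset $S\subset M$ is a geodesic $(\alpha,E)$-invex set with respect to $\eta$ and $\alpha$ if for every $x,y\in S$ there exists exactly one geodesic $\gamma_{E(x),E(y)}:[0,1]\to M$ such that $\gamma_{E(x),E(y)}(0)=E(y)$, $\gamma'_{E(x),E(y)}(0)=\alpha(E(x),E(y))\,\eta(E(x),E(y))$, and $\gamma_{E(x),E(y)}(t)\in S$ for all $t\in[0,1]$. (In particular $E(x)\in S$ for all $x\in S$.) Geodesic $(\alpha,E)$-preinvex function: for $S$ an open geodesic $(\alpha,E)$-invex set, $f:S\to\mathbb{R}$ is geodesic $(\alpha,E)$-preinvex if $f(\gamma_{E(x),E(y)}(t))\le t f(E(x))+(1-t)f(E(y))$ for all $x,y\in S$ and $t\in[0,1]$, where $\gamma_{E(x),E(y)}$ is the unique geodesic above. Geodesic $(\alpha,E)$-invex function: for $S$ an open geodesic $(\alpha,E)$-invex set, a differentiable $f:S\to\mathbb{R}$ is geodesic $(\alpha,E)$-invex if $f(E(x))-f(E(y))\ge df_{E(y)}\big(\alpha(E(x),E(y))\,\eta(E(x),E(y))\big)$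 for all $x,y\in S$. *)

theory Defs
  imports "HOL-Analysis.Analysis"
begin

text \<open>
  A manifold is a whole topological type \<open>'m\<close> with a smooth atlas of charts in a
  finite-dimensional normed space \<open>'e\<close>. (The class \<open>euclidean_space\<close> is not used for \<open>'e\<close>
  because it excludes dimension zero.) Coordinate maps and curves are total
  functions in HOL; their values outside the chart domain or the parameter interval are
  irrelevant.
\<close>

section \<open>Smooth manifolds\<close>

text \<open>For an open subset of a finite-dimensional space, being of class \<open>C\<^sup>k\<^sup>+\<^sup>1\<close> is the same as being
  differentiable with all directional derivatives of class \<open>C\<^sup>k\<close>.\<close>

primrec Ck_on :: "nat \<Rightarrow> 'a::real_normed_vector set \<Rightarrow> ('a \<Rightarrow> 'b::real_normed_vector) \<Rightarrow> bool" where
  "Ck_on 0 X f \<longleftrightarrow> continuous_on X f"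
| "Ck_on (Suc k) X f \<longleftrightarrow>
     (\<forall>x\<in>X. f differentiable (at x)) \<and> (\<forall>v. Ck_on k X (\<lambda>x. frechet_derivative f (at x) v))"

definition smooth_on :: "'a::real_normed_vector set \<Rightarrow> ('a \<Rightarrow> 'b::real_normed_vector) \<Rightarrow> bool" where
  "smooth_on X f \<longleftrightarrow> (\<forall>k. Ck_on k X f)"

type_synonym ('m, 'e) chart = "'m set \<times> ('m \<Rightarrow> 'e)"

abbreviation chart_dom :: "('m, 'e) chart \<Rightarrow> 'm set" where
  "chart_dom c \<equiv> fst c"

abbreviation chart_map :: "('m, 'e) chart \<Rightarrow> 'm \<Rightarrow> 'e" where
  "chart_map c \<equiv> snd c"

abbreviation chart_inv :: "('m, 'e) chart \<Rightarrow> 'e \<Rightarrow> 'm" where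
  "chart_inv c \<equiv> inv_into (chart_dom c) (chart_map c)"

definition smooth_atlas ::
  "('m::{t2_space, second_countable_topology}, 'e::real_normed_vector) chart set \<Rightarrow> bool" where
  "smooth_atlas A \<longleftrightarrow>
     (\<exists>B::'e set. finite B \<and> span B = UNIV) \<and>
     (\<Union>c\<in>A. chart_dom c) = UNIV \<and>
     (\<forall>c\<in>A. open (chart_dom c) \<and> open (chart_map c ` chart_dom c) \<and>
        homeomorphism (chart_dom c) (chart_map c ` chart_dom c) (chart_map c) (chart_inv c)) \<and>
     (\<forall>c\<in>A. \<forall>d\<in>A. smooth_on (chart_map c ` (chart_dom c \<inter> chart_dom d))
        (chart_map d \<circ> chart_inv c))"

section \<open>Tangent vectors and differentials\<close>

text \<open>A tangent vector is a base point together with its component in every chart of the atlas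
  around this point, the components being related by the derivatives of the transition maps.
  Components for all other charts are set to zero, which makes the representation unique.\<close>

datatype ('m, 'e) tangent_vec =
  TVec (base: 'm) (comp: "('m, 'e) chart \<Rightarrow> 'e")

definition tangent_space ::
  "('m, 'e::real_normed_vector) chart set \<Rightarrow> 'm \<Rightarrow> ('m, 'e) tangent_vec set" where
  "tangent_space A p = {v. base v = p \<and>
     (\<forall>c. \<not> (c \<in> A \<and> p \<in> chart_dom c) \<longrightarrow> comp v c = 0) \<and>
     (\<forall>c\<in>A. \<forall>d\<in>A. p \<in> chart_dom c \<and> p \<in> chart_dom d \<longrightarrow>
        comp v d = frechet_derivative (chart_map d \<circ> chart_inv c) (at (chart_map c p)) (comp v c))}"

definition tangent_bundle ::
  "('m, 'e::real_normed_vector) chart set \<Rightarrow> ('m, 'e) tangent_vec set" where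
  "tangent_bundle A = (\<Union>p. tangent_space A p)"

definition tscale :: "real \<Rightarrow> ('m, 'e::real_normed_vector) tangent_vec \<Rightarrow> ('m, 'e) tangent_vec" where
  "tscale a v = TVec (base v) (\<lambda>c. a *\<^sub>R comp v c)"

text \<open>Addition is meaningful only for two vectors with the same base point.\<close>

definition tadd ::
  "('m, 'e::real_normed_vector) tangent_vec \<Rightarrow> ('m, 'e) tangent_vec \<Rightarrow> ('m, 'e) tangent_vec" where
  "tadd v w = TVec (base v) (\<lambda>c. comp v c + comp w c)"

text \<open>The tangent vector at \<open>p\<close> that has component \<open>a\<close> in the chart \<open>c\<close>.\<close>

definition coord_vec ::
  "('m, 'e::real_normed_vector) chart set \<Rightarrow> ('m, 'e) chart \<Rightarrow> 'm \<Rightarrow> 'e \<Rightarrow> ('m, 'e) tangent_vec" where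
  "coord_vec A c p a = TVec p (\<lambda>d. if d \<in> A \<and> p \<in> chart_dom d
     then frechet_derivative (chart_map d \<circ> chart_inv c) (at (chart_map c p)) a else 0)"

text \<open>The derivative at an endpoint of the interval \<open>I\<close> is one-sided.\<close>

definition velocity ::
  "('m, 'e::real_normed_vector) chart set \<Rightarrow> real set \<Rightarrow> (real \<Rightarrow> 'm) \<Rightarrow> real \<Rightarrow> ('m, 'e) tangent_vec" where
  "velocity A I \<gamma> t = TVec (\<gamma> t) (\<lambda>c. if c \<in> A \<and> \<gamma> t \<in> chart_dom c
     then vector_derivative (chart_map c \<circ> \<gamma>) (at t within I) else 0)"

text \<open>A function on an open subset \<open>S\<close> is a total function of which only the values on \<open>S\<close> matter:
  differentiability and differential at a point of \<open>S\<close> depend only on the function near this point.\<close>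

definition differentiable_fun_on ::
  "('m, 'e::real_normed_vector) chart set \<Rightarrow> 'm set \<Rightarrow> ('m \<Rightarrow> real) \<Rightarrow> bool" where
  "differentiable_fun_on A S f \<longleftrightarrow>
     (\<forall>p\<in>S. \<forall>c\<in>A. p \<in> chart_dom c \<longrightarrow> (f \<circ> chart_inv c) differentiable (at (chart_map c p)))"

text \<open>By the chain rule the value does not depend on which chart around the base point is chosen.\<close>

definition differential ::
  "('m, 'e::real_normed_vector) chart set \<Rightarrow> ('m \<Rightarrow> real) \<Rightarrow> ('m, 'e) tangent_vec \<Rightarrow> real" where
  "differential A f v = (let c = (SOME c. c \<in> A \<and> base v \<in> chart_dom c)
     in frechet_derivative (f \<circ> chart_inv c) (at (chart_map c (base v))) (comp v c))"

section \<open>Riemannian metrics and geodesics\<close>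

type_synonym ('m, 'e) metric = "('m, 'e) tangent_vec \<Rightarrow> ('m, 'e) tangent_vec \<Rightarrow> real"

definition local_metric ::
  "('m, 'e::real_normed_vector) chart set \<Rightarrow> ('m, 'e) metric \<Rightarrow> ('m, 'e) chart \<Rightarrow>
     'e \<Rightarrow> 'e \<Rightarrow> 'e \<Rightarrow> real" where
  "local_metric A g c z a b =
     g (coord_vec A c (chart_inv c z) a) (coord_vec A c (chart_inv c z) b)"

definition riemannian_metric ::
  "('m, 'e::real_normed_vector) chart set \<Rightarrow> ('m, 'e) metric \<Rightarrow> bool" where
  "riemannian_metric A g \<longleftrightarrow>
     (\<forall>p. \<forall>u\<in>tangent_space A p. \<forall>v\<in>tangent_space A p. \<forall>w\<in>tangent_space A p. \<forall>a.
        g u v = g v u \<and> g (tadd u v) w = g u w + g v w \<and> g (tscale a u) w = a * g u w \<and>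
        (u \<noteq> TVec p (\<lambda>_. 0) \<longrightarrow> g u u > 0)) \<and>
     (\<forall>c\<in>A. \<forall>a b. smooth_on (chart_map c ` chart_dom c) (\<lambda>z. local_metric A g c z a b))"

text \<open>The Christoffel map of the Levi-Civita connection in the chart \<open>c\<close> at the coordinate \<open>z\<close>,
  that is, \<open>\<nabla>\<^bsub>X\<^esub> Y\<close> for the constant coordinate fields \<open>X = a\<close> and \<open>Y = b\<close>, whose Lie bracket is zero.
  It is given by the Koszul formula; in components this is
  \<open>\<Gamma>\<^sup>k\<^sub>i\<^sub>j g\<^sub>k\<^sub>l = (\<partial>\<^sub>i g\<^sub>j\<^sub>l + \<partial>\<^sub>j g\<^sub>i\<^sub>l - \<partial>\<^sub>l g\<^sub>i\<^sub>j) / 2\<close>.\<close>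

definition christoffel ::
  "('m, 'e::real_normed_vector) chart set \<Rightarrow> ('m, 'e) metric \<Rightarrow> ('m, 'e) chart \<Rightarrow>
     'e \<Rightarrow> 'e \<Rightarrow> 'e \<Rightarrow> 'e" where
  "christoffel A g c z a b = (THE u. \<forall>w. local_metric A g c z u w =
     (frechet_derivative (\<lambda>y. local_metric A g c y b w) (at z) a
      + frechet_derivative (\<lambda>y. local_metric A g c y a w) (at z) b
      - frechet_derivative (\<lambda>y. local_metric A g c y a b) (at z) w) / 2)"

text \<open>The geodesic equation \<open>\<nabla>\<^bsub>\<gamma>'\<^esub> \<gamma>' = 0\<close>, that is, \<open>x'' = - \<Gamma>(x', x')\<close> for the
  coordinate expression \<open>x\<close> of the curve in each chart; \<open>I\<close> is an interval.\<close>

definition geodesic_on ::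
  "('m::topological_space, 'e::real_normed_vector) chart set \<Rightarrow> ('m, 'e) metric \<Rightarrow>
     real set \<Rightarrow> (real \<Rightarrow> 'm) \<Rightarrow> bool" where
  "geodesic_on A g I \<gamma> \<longleftrightarrow> continuous_on I \<gamma> \<and>
     (\<forall>c\<in>A. \<forall>t\<in>I. \<gamma> t \<in> chart_dom c \<longrightarrow>
        (let x = chart_map c \<circ> \<gamma>; x' = (\<lambda>s. vector_derivative x (at s within I))
         in x differentiable (at t within I) \<and>
            (x' has_vector_derivative - christoffel A g c (x t) (x' t) (x' t)) (at t within I)))"

text \<open>Completeness: every geodesic extends to all of \<open>\<real>\<close>. The manifold need not be connected.\<close>

definition complete_riemannian_manifold ::
  "('m::{t2_space, second_countable_topology}, 'e::real_normed_vector) chart set \<Rightarrow>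
     ('m, 'e) metric \<Rightarrow> bool" where
  "complete_riemannian_manifold A g \<longleftrightarrow> smooth_atlas A \<and> riemannian_metric A g \<and>
     (\<forall>p. \<forall>v\<in>tangent_space A p. \<exists>\<gamma>. geodesic_on A g UNIV \<gamma> \<and> \<gamma> 0 = p \<and> velocity A UNIV \<gamma> 0 = v)"

section \<open>Geodesic invexity\<close>

text \<open>The points \<open>u\<close> and \<open>v\<close> stand for \<open>E x\<close> and \<open>E y\<close>. A curve on \<open>[0,1]\<close> is
  represented by an extensional function, so that uniqueness is meant on \<open>[0,1]\<close>.\<close>

definition invex_geodesic ::
  "('m::topological_space, 'e::real_normed_vector) chart set \<Rightarrow> ('m, 'e) metric \<Rightarrow>
     ('m \<Rightarrow> 'm \<Rightarrow> real) \<Rightarrow> ('m \<Rightarrow> 'm \<Rightarrow> ('m, 'e) tangent_vec) \<Rightarrow> 'm set \<Rightarrow> 'm \<Rightarrow> 'm \<Rightarrow>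
     (real \<Rightarrow> 'm) \<Rightarrow> bool" where
  "invex_geodesic A g \<alpha> \<eta> S u v \<gamma> \<longleftrightarrow>
     \<gamma> \<in> extensional {0..1} \<and> geodesic_on A g {0..1} \<gamma> \<and>
     \<gamma> 0 = v \<and> velocity A {0..1} \<gamma> 0 = tscale (\<alpha> u v) (\<eta> u v) \<and> (\<forall>t\<in>{0..1}. \<gamma> t \<in> S)"

definition geodesic_invex_set ::
  "('m::topological_space, 'e::real_normed_vector) chart set \<Rightarrow> ('m, 'e) metric \<Rightarrow> ('m \<Rightarrow> 'm) \<Rightarrow>
     ('m \<Rightarrow> 'm \<Rightarrow> real) \<Rightarrow> ('m \<Rightarrow> 'm \<Rightarrow> ('m, 'e) tangent_vec) \<Rightarrow> 'm set \<Rightarrow> bool" where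
  "geodesic_invex_set A g E \<alpha> \<eta> S \<longleftrightarrow>
     S \<noteq> {} \<and> (\<forall>x\<in>S. \<forall>y\<in>S. \<exists>!\<gamma>. invex_geodesic A g \<alpha> \<eta> S (E x) (E y) \<gamma>)"

text \<open>The next two notions are meant for an open geodesic invex set \<open>S\<close>, where the description
  by \<open>THE\<close> denotes the unique geodesic.\<close>

definition geodesic_preinvex_fun ::
  "('m::topological_space, 'e::real_normed_vector) chart set \<Rightarrow> ('m, 'e) metric \<Rightarrow> ('m \<Rightarrow> 'm) \<Rightarrow>
     ('m \<Rightarrow> 'm \<Rightarrow> real) \<Rightarrow> ('m \<Rightarrow> 'm \<Rightarrow> ('m, 'e) tangent_vec) \<Rightarrow> 'm set \<Rightarrow> ('m \<Rightarrow> real) \<Rightarrow> bool" where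
  "geodesic_preinvex_fun A g E \<alpha> \<eta> S f \<longleftrightarrow>
     (\<forall>x\<in>S. \<forall>y\<in>S. \<forall>t\<in>{0..1}.
        f ((THE \<gamma>. invex_geodesic A g \<alpha> \<eta> S (E x) (E y) \<gamma>) t) \<le> t * f (E x) + (1 - t) * f (E y))"

definition geodesic_invex_fun ::
  "('m, 'e::real_normed_vector) chart set \<Rightarrow> ('m \<Rightarrow> 'm) \<Rightarrow>
     ('m \<Rightarrow> 'm \<Rightarrow> real) \<Rightarrow> ('m \<Rightarrow> 'm \<Rightarrow> ('m, 'e) tangent_vec) \<Rightarrow> 'm set \<Rightarrow> ('m \<Rightarrow> real) \<Rightarrow> bool" where
  "geodesic_invex_fun A E \<alpha> \<eta> S f \<longleftrightarrow> differentiable_fun_on A S f \<and>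
     (\<forall>x\<in>S. \<forall>y\<in>S.
        f (E x) - f (E y) \<ge> differential A f (tscale (\<alpha> (E x) (E y)) (\<eta> (E x) (E y))))"

end

theory Submission
  imports Defs
begin

text \<open>
  Along the geodesic \<open>\<gamma>\<close> from \<open>E y\<close> with initial velocity \<open>\<alpha> \<eta>\<close>, the chain rule gives
  \<open>(f \<circ> \<gamma>)'(0) = df(\<alpha> \<eta>)\<close>. Preinvexity bounds the difference quotients
  \<open>(f (\<gamma> t) - f (\<gamma> 0)) / t\<close>, \<open>0 < t \<le> 1\<close>, by \<open>f (E x) - f (E y)\<close>, and the bound passes to the
  limit \<open>t \<rightarrow> 0\<close>.
\<close>

lemma base_velocity [simp]: "base (velocity A I \<gamma> t) = \<gamma> t"
  by (simp add: velocity_def)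

text \<open>Chain rule in one chart around \<open>\<gamma> t\<close>: there
  \<open>f \<circ> \<gamma>\<close> factors through the coordinate expression of \<open>f\<close>
  and that of the curve. Derivatives are taken within \<open>I\<close>, so one-sided ones at
  endpoints are covered.\<close>

lemma has_vector_derivative_along_geodesic:
  fixes A :: "('m::{t2_space, second_countable_topology}, 'e::real_normed_vector) chart set"
  assumes atlas: "smooth_atlas A"
    and geo: "geodesic_on A g I \<gamma>"
    and f: "differentiable_fun_on A S f"
    and t: "t \<in> I" and S: "\<gamma> t \<in> S"
  shows "((f \<circ> \<gamma>) has_vector_derivative differential A f (velocity A I \<gamma> t)) (at t within I)"
proof -
  \<comment> \<open>The same choice of chart as in \<open>differential\<close>, so that
    \<open>differential A f\<close> at the velocity is by definition the derivative computed in this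
    chart.\<close>
  define c where "c = (SOME c. c \<in> A \<and> \<gamma> t \<in> chart_dom c)"
  have "\<exists>c. c \<in> A \<and> \<gamma> t \<in> chart_dom c"
    using atlas unfolding smooth_atlas_def by blast
  then have cA: "c \<in> A" and ct: "\<gamma> t \<in> chart_dom c"
    unfolding c_def by (rule someI2_ex, simp)+
  have op: "open (chart_dom c)"
    and hom: "homeomorphism (chart_dom c) (chart_map c ` chart_dom c) (chart_map c) (chart_inv c)"
    using atlas cA unfolding smooth_atlas_def by blast+
  let ?x = "chart_map c \<circ> \<gamma>"
  let ?v = "vector_derivative ?x (at t within I)"
  let ?F = "f \<circ> chart_inv c"
  let ?D = "frechet_derivative ?F (at (?x t))"
  have "?x differentiable (at t within I)"
    using geo cA t ct unfolding geodesic_on_def Let_def by blast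
  then have x: "(?x has_vector_derivative ?v) (at t within I)"
    by (simp add: vector_derivative_works)
  have "?F differentiable (at (?x t))"
    using f S cA ct by (auto simp: differentiable_fun_on_def)
  then have F: "(?F has_derivative ?D) (at (?x t))"
    by (simp add: frechet_derivative_works)
  have "((?F \<circ> ?x) has_vector_derivative ?D ?v) (at t within I)"
    using x has_derivative_at_withinI [OF F] by (rule vector_derivative_diff_chain_within)
  \<comment> \<open>\<open>chart_inv c\<close> undoes \<open>chart_map c\<close> only on the chart
    domain; by continuity \<open>\<gamma>\<close> stays in this open set near
    \<open>t\<close>.\<close>
  moreover have "eventually (\<lambda>s. \<gamma> s \<in> chart_dom c) (at t within I)"
  proof -
    have "(\<gamma> \<longlongrightarrow> \<gamma> t) (at t within I)"
      using geo t by (simp add: geodesic_on_def continuous_on_def)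
    then show ?thesis using op ct by (rule topological_tendstoD)
  qed
  then have "eventually (\<lambda>s. (?F \<circ> ?x) s = (f \<circ> \<gamma>) s) (at t within I)"
    by (rule eventually_mono) (simp add: homeomorphism_apply1 [OF hom])
  \<comment> \<open>The filter \<open>at t within I\<close> omits \<open>t\<close> itself, so
    agreement there is a separate fact.\<close>
  moreover have "(?F \<circ> ?x) t = (f \<circ> \<gamma>) t"
    using ct by (simp add: homeomorphism_apply1 [OF hom])
  ultimately have "((f \<circ> \<gamma>) has_vector_derivative ?D ?v) (at t within I)"
    unfolding has_vector_derivative_def
    by (rule has_derivative_transform_eventually) (rule t)
  moreover have "differential A f (velocity A I \<gamma> t) = ?D ?v"
    using cA ct by (simp add: differential_def Let_def velocity_def flip: c_def)
  ultimately show ?thesis by simp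
qed

text \<open>The graph lies below the segment from \<open>(0, \<phi> 0)\<close> to
  \<open>(1, a)\<close>, whose slope bounds all difference quotients at 0. The value
  \<open>a\<close> is kept apart from \<open>\<phi> 1\<close> because the geodesic from
  \<open>E y\<close> may end elsewhere than at \<open>E x\<close>.\<close>

lemma right_derivative_le_chord:
  fixes \<phi> :: "real \<Rightarrow> real"
  assumes der: "(\<phi> has_vector_derivative d) (at 0 within {0..1})"
    and le: "\<And>t. t \<in> {0..1} \<Longrightarrow> \<phi> t \<le> t * a + (1 - t) * \<phi> 0"
  shows "d \<le> a - \<phi> 0"
proof -
  have "((\<lambda>t. (\<phi> t - \<phi> 0) / (t - 0)) \<longlongrightarrow> d) (at 0 within {0..1})"
    using der by (simp add: has_field_derivative_iff
      flip: has_real_derivative_iff_has_vector_derivative)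
  moreover have "eventually (\<lambda>t. (\<phi> t - \<phi> 0) / (t - 0) \<le> a - \<phi> 0) (at 0 within {0..1})"
    unfolding eventually_at_filter
  proof (intro always_eventually allI impI)
    fix t :: real
    assume "t \<noteq> 0" "t \<in> {0..1}"
    then have "0 < t" by simp
    then show "(\<phi> t - \<phi> 0) / (t - 0) \<le> a - \<phi> 0"
      using le [OF \<open>t \<in> {0..1}\<close>] by (simp add: pos_divide_le_eq) (simp add: algebra_simps)
  qed
  \<comment> \<open>0 is a limit point of the interval, so the bound survives in the limit.\<close>
  moreover have "at 0 within {0..1::real} \<noteq> bot"
    by (simp add: trivial_limit_within islimpt_Icc)
  ultimately show ?thesis by (rule tendsto_upperbound)
qed

theorem theorem4p2:
  fixes A :: "('m::{t2_space, second_countable_topology}, 'e::real_normed_vector) chart set"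
    and g :: "('m, 'e) metric"
    and E :: "'m \<Rightarrow> 'm"
    and \<alpha> :: "'m \<Rightarrow> 'm \<Rightarrow> real"
    and \<eta> :: "'m \<Rightarrow> 'm \<Rightarrow> ('m, 'e) tangent_vec"
    and S :: "'m set"
    and f :: "'m \<Rightarrow> real"
  assumes "complete_riemannian_manifold A g"
    and "\<forall>x y. \<alpha> x y \<noteq> 0"
    and "\<forall>x y. \<eta> x y \<in> tangent_bundle A"
    and "\<forall>x y. tscale (\<alpha> x y) (\<eta> x y) \<in> tangent_space A y"
    and "open S"
    and "geodesic_invex_set A g E \<alpha> \<eta> S"
    and "differentiable_fun_on A S f"
    and "geodesic_preinvex_fun A g E \<alpha> \<eta> S f"
  shows "geodesic_invex_fun A E \<alpha> \<eta> S f"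
  unfolding geodesic_invex_fun_def
proof (intro conjI ballI)
  show f: "differentiable_fun_on A S f" by fact
  fix x y
  assume xy: "x \<in> S" "y \<in> S"
  \<comment> \<open>The description used in \<open>geodesic_preinvex_fun\<close>; unique existence
    turns it into an actual geodesic to which the preinvexity bound applies.\<close>
  define \<gamma> where "\<gamma> = (THE \<gamma>. invex_geodesic A g \<alpha> \<eta> S (E x) (E y) \<gamma>)"
  have "\<exists>!\<gamma>. invex_geodesic A g \<alpha> \<eta> S (E x) (E y) \<gamma>"
    using assms(6) xy by (simp add: geodesic_invex_set_def)
  then have "invex_geodesic A g \<alpha> \<eta> S (E x) (E y) \<gamma>"
    unfolding \<gamma>_def by (rule theI')
  \<comment> \<open>The curve stays in \<open>S\<close>, so its starting point \<open>E y\<close> is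
    a point where \<open>f\<close> is differentiable.\<close>
  then have geo: "geodesic_on A g {0..1} \<gamma>" and 0: "\<gamma> 0 = E y" and S: "\<gamma> 0 \<in> S"
    and vel: "velocity A {0..1} \<gamma> 0 = tscale (\<alpha> (E x) (E y)) (\<eta> (E x) (E y))"
    unfolding invex_geodesic_def by simp_all force
  have "smooth_atlas A"
    using assms(1) by (simp add: complete_riemannian_manifold_def)
  from has_vector_derivative_along_geodesic [OF this geo f _ S]
  have "((f \<circ> \<gamma>) has_vector_derivative
      differential A f (tscale (\<alpha> (E x) (E y)) (\<eta> (E x) (E y)))) (at 0 within {0..1})"
    by (simp add: vel)
  moreover have "(f \<circ> \<gamma>) t \<le> t * f (E x) + (1 - t) * (f \<circ> \<gamma>) 0" if "t \<in> {0..1}" for t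
    using assms(8) xy that 0 by (simp add: geodesic_preinvex_fun_def \<gamma>_def)
  ultimately have "differential A f (tscale (\<alpha> (E x) (E y)) (\<eta> (E x) (E y)))
      \<le> f (E x) - (f \<circ> \<gamma>) 0"
    by (rule right_derivative_le_chord)
  then show "differential A f (tscale (\<alpha> (E x) (E y)) (\<eta> (E x) (E y))) \<le> f (E x) - f (E y)"
    by (simp add: 0)
qed

end
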